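(* Let $n\in\mathbb{N}$ and let $e_n$ be the polynomial of degree $n$ satisfying $e_n'(x)+e_n(x)=x^n$. The general solution of the second-order differential equation $$x y''+(x-n)y'-n y=0$$ is $$y(x)=C_1\,e^{-x}+C_2\,e_n(x),$$ with $C_1,C_2$ arbitrary constants. In particular, the polynomial $e_n$ is a solution of this equation, and the second linearly independent solution is the function $y=e^{-x}$.
   Context: $\mathbb{N}=\{0,1,2,\dots\}$; $y$ is a function of the variable $x$, and a prime denotes differentiation with respect to $x$.
   Formalization: On intervals containing the singular point x = 0 the general solution is taken among infinitely differentiable functions, since for n ≥ 2 other twice differentiable solutions exist there; on intervals avoiding 0 twice differentiable solutions are covered. *)

theory Defs
  imports "HOL-Analysis.Analysis" "HOL-Computational_Algebra.Polynomial"
begin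

text \<open>Classical real solutions of \<open>x y'' + (x - n) y' - n y = 0\<close> on \<open>S\<close>. The predicates below are
  meant for open \<open>S\<close>, where \<^const>\<open>deriv\<close> and derivatives within \<open>S\<close> agree.\<close>

definition solves_ode_on :: "nat \<Rightarrow> real set \<Rightarrow> (real \<Rightarrow> real) \<Rightarrow> bool" where
  "solves_ode_on n S y \<longleftrightarrow>
     y differentiable_on S \<and> deriv y differentiable_on S \<and>
     (\<forall>x\<in>S. x * deriv (deriv y) x + (x - real n) * deriv y x - real n * y x = 0)"

definition infinitely_differentiable_on :: "(real \<Rightarrow> real) \<Rightarrow> real set \<Rightarrow> bool" where
  "infinitely_differentiable_on y S \<longleftrightarrow> (\<forall>k. (deriv ^^ k) y differentiable_on S)"

text \<open>The equation is singular at \<open>0\<close>. With \<open>p\<close> the polynomial characterised in the lemma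
  \<open>ex1_exp_poly\<close> below, the function \<open>p(x) - (-1)\<^sup>n n! e\<^sup>-\<^sup>x\<close> vanishes to order \<open>n + 1\<close> at \<open>0\<close>; for
  \<open>n \<ge> 2\<close>, extending it by \<open>0\<close> from the positive half-line to the whole line gives a twice differentiable
  solution that is not a combination of \<open>e\<^sup>-\<^sup>x\<close> and \<open>p\<close>. Hence on intervals containing \<open>0\<close> the general
  solution is taken among infinitely differentiable functions, and on all other intervals among
  all twice differentiable ones.\<close>

definition general_solution_of_ode ::
  "nat \<Rightarrow> (real \<Rightarrow> real) \<Rightarrow> (real \<Rightarrow> real) \<Rightarrow> bool" where
  "general_solution_of_ode n u v \<longleftrightarrow>
     (\<forall>C1 C2. solves_ode_on n UNIV (\<lambda>x. C1 * u x + C2 * v x)) \<and>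
     (\<forall>S y. open S \<and> is_interval S \<and> solves_ode_on n S y \<and>
        (0 \<in> S \<longrightarrow> infinitely_differentiable_on y S) \<longrightarrow>
        (\<exists>C1 C2. \<forall>x\<in>S. y x = C1 * u x + C2 * v x))"

definition linearly_independent_pair_on ::
  "real set \<Rightarrow> (real \<Rightarrow> real) \<Rightarrow> (real \<Rightarrow> real) \<Rightarrow> bool" where
  "linearly_independent_pair_on S u v \<longleftrightarrow>
     (\<forall>a b. (\<forall>x\<in>S. a * u x + b * v x = 0) \<longrightarrow> a = 0 \<and> b = 0)"

lemma ex1_exp_poly:
  "\<exists>!p :: real poly. degree p = n \<and> (\<forall>x. poly (pderiv p) x + poly p x = x ^ n)"
proof -
  have ex: "\<exists>p :: real poly. degree p = n \<and> pderiv p + p = monom 1 n"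
  proof (induction n)
    case 0
    show ?case by (rule exI[of _ 1]) (simp add: monom_0 one_pCons)
  next
    case (Suc n)
    then obtain p :: "real poly" where p: "degree p = n" "pderiv p + p = monom 1 n" by blast
    let ?q = "monom 1 (Suc n) - smult (real (Suc n)) p"
    have "pderiv ?q + ?q =
        monom 1 (Suc n) + pderiv (monom 1 (Suc n)) - smult (real (Suc n)) (pderiv p + p)"
      by (simp add: pderiv_diff pderiv_smult smult_add_right)
    also have "\<dots> = monom 1 (Suc n)" by (simp add: p pderiv_monom smult_monom)
    finally have "pderiv ?q + ?q = monom 1 (Suc n)" .
    moreover have "degree ?q = Suc n"
    proof (rule antisym)
      show "degree ?q \<le> Suc n"
        by (intro degree_diff_le) (auto simp: degree_monom_le p)
      show "Suc n \<le> degree ?q"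
        by (rule le_degree) (simp add: p coeff_eq_0)
    qed
    ultimately show ?case by blast
  qed
  have uniq: "p = q" if "pderiv p + p = pderiv q + q" for p q :: "real poly"
  proof (rule ccontr)
    let ?d = "p - q"
    assume "p \<noteq> q"
    then have d: "?d \<noteq> 0" by simp
    have eq: "pderiv ?d = - ?d" using that by (simp add: pderiv_diff algebra_simps)
    then have "degree ?d = degree ?d - 1" by (metis degree_minus degree_pderiv)
    then have "degree ?d = 0" by linarith
    then have "pderiv ?d = 0" by (simp add: pderiv_eq_0_iff)
    with eq d show False by simp
  qed
  have iff: "(\<forall>x. poly (pderiv p) x + poly p x = x ^ n) \<longleftrightarrow> pderiv p + p = monom 1 n"
    for p :: "real poly"
    by (simp add: poly_eq_poly_eq_iff[symmetric] fun_eq_iff poly_monom)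
  show ?thesis unfolding iff using ex uniq by metis
qed

end

(* The left-hand side equals x w' - n w with w = y' + y.  Hence w = c x^n: away from 0 because
   (w / x^n)' = 0; on an interval around 0 because differentiating x w' = n w repeatedly gives
   x w^(k+1) = (n - k) w^(k), so that w^(n) is constant and w^(n-1), ..., w^(0) are determined
   successively.  Finally y - c e solves z' + z = 0. *)
theory Submission
  imports Defs
begin

lemma differentiable_on_open_DERIV_deriv:
  fixes f :: "real \<Rightarrow> real"
  assumes "f differentiable_on S" "open S" "x \<in> S"
  shows "(f has_real_derivative deriv f x) (at x)"
  using assms
  by (metis DERIV_imp_deriv at_within_open differentiable_on_def real_differentiable_def)

text \<open>With w = y' + y the equation reads x w' = n w. The exponential gives w = 0 and
  \<open>e\<close> gives w = x^n, and both satisfy this, so every combination does.\<close>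

lemma solves_ode_on_combination:
  fixes e :: "real poly"
  assumes "\<forall>x. poly (pderiv e) x + poly e x = x ^ n"
  shows "solves_ode_on n UNIV (\<lambda>x. C1 * exp (- x) + C2 * poly e x)"
proof -
  let ?y = "\<lambda>x. C1 * exp (- x) + C2 * poly e x"
  let ?y1 = "\<lambda>x. - C1 * exp (- x) + C2 * poly (pderiv e) x"
  let ?y2 = "\<lambda>x. C1 * exp (- x) + C2 * poly (pderiv (pderiv e)) x"
  have D1: "(?y has_real_derivative ?y1 x) (at x)" for x
    by (auto intro!: derivative_eq_intros)
  have D2: "(?y1 has_real_derivative ?y2 x) (at x)" for x
    by (auto intro!: derivative_eq_intros)
  have d1: "deriv ?y = ?y1" using D1 by (blast intro: DERIV_imp_deriv)
  have d2: "deriv ?y1 = ?y2" using D2 by (blast intro: DERIV_imp_deriv)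
  have e2: "poly (pderiv (pderiv e)) x + poly (pderiv e) x = real n * x ^ (n - 1)" for x
  proof (rule DERIV_unique)
    show "((\<lambda>x. poly (pderiv e) x + poly e x) has_real_derivative
        poly (pderiv (pderiv e)) x + poly (pderiv e) x) (at x)"
      by (auto intro!: derivative_eq_intros)
    show "((\<lambda>x. poly (pderiv e) x + poly e x) has_real_derivative real n * x ^ (n - 1)) (at x)"
      using assms by (auto intro!: derivative_eq_intros)
  qed
  have ode: "x * ?y2 x + (x - real n) * ?y1 x - real n * ?y x = 0" for x
  proof -
    have "x * ?y2 x + (x - real n) * ?y1 x - real n * ?y x
        = C2 * (x * (poly (pderiv (pderiv e)) x + poly (pderiv e) x)
            - real n * (poly (pderiv e) x + poly e x))"
      by (simp add: algebra_simps)
    also have "\<dots> = C2 * (x * (real n * x ^ (n - 1)) - real n * x ^ n)"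
      using e2 assms by simp
    \<comment> \<open>For n = 0 the exponent \<open>n - 1\<close> truncates to 0 and x * x^(n-1) =
      x^n breaks down, but then the factor \<open>real n\<close> vanishes.\<close>
    also have "\<dots> = 0" by (cases n) auto
    finally show ?thesis .
  qed
  have "?y differentiable_on UNIV" "?y1 differentiable_on UNIV"
    using D1 D2 by (meson differentiable_at_imp_differentiable_on real_differentiable_def)+
  then show ?thesis using ode unfolding solves_ode_on_def d1 d2 by blast
qed

lemma euler_ode_solution_away_from_zero:
  fixes w w' :: "real \<Rightarrow> real"
  assumes "convex S" "0 \<notin> S"
    and D: "\<And>x. x \<in> S \<Longrightarrow> (w has_real_derivative w' x) (at x)"
    and eq: "\<And>x. x \<in> S \<Longrightarrow> x * w' x = real n * w x"
  shows "\<exists>c. \<forall>x\<in>S. w x = c * x ^ n"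
proof -
  have "((\<lambda>x. w x / x ^ n) has_real_derivative 0) (at x within S)" if x: "x \<in> S" for x
  proof -
    have x0: "x \<noteq> 0" using x assms(2) by auto
    \<comment> \<open>The bracket is the numerator of the quotient rule for w / x^n. The extra
      factor x, cancelled afterwards, turns w' into x w', to which the equation applies.\<close>
    have "x * (w' x * x ^ n - w x * (real n * x ^ (n - 1))) =
        (x * w' x) * x ^ n - real n * w x * (x * x ^ (n - 1))"
      by (simp add: algebra_simps)
    also have "\<dots> = 0" by (cases n) (use eq[OF x] in auto)
    finally have "w' x * x ^ n - w x * (real n * x ^ (n - 1)) = 0" using x0 by simp
    then show ?thesis
      using x0 DERIV_divide[OF D[OF x] DERIV_pow[of n x]]
      by (simp add: has_field_derivative_at_within)
  qed
  from has_field_derivative_zero_constant[OF assms(1) this]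
  obtain c where c: "w x / x ^ n = c" if "x \<in> S" for x by blast
  have "w x = c * x ^ n" if "x \<in> S" for x
    using c[OF that] that assms(2) by (auto simp: field_simps)
  then show ?thesis by blast
qed

text \<open>\<open>W k\<close> plays the role of the k-th derivative of w. Dividing by x^n would
  leave unrelated constants on the two sides of 0; the n-th derivative links them, because it is
  continuous across 0.\<close>

lemma euler_ode_smooth_solution:
  fixes W :: "nat \<Rightarrow> real \<Rightarrow> real"
  assumes "open S" "convex S"
    and D: "\<And>k x. x \<in> S \<Longrightarrow> (W k has_real_derivative W (Suc k) x) (at x)"
    and eq: "\<And>x. x \<in> S \<Longrightarrow> x * W 1 x = real n * W 0 x"
  shows "\<exists>c. \<forall>x\<in>S. W 0 x = c * x ^ n"
proof -
  have rec: "\<forall>x\<in>S. x * W (Suc k) x = (real n - real k) * W k x" for k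
  proof (induction k)
    case 0
    then show ?case using eq by simp
  next
    case (Suc k)
    show ?case
    proof
      fix x assume x: "x \<in> S"
      \<comment> \<open>The induction hypothesis holds on an open set, so both of its sides may be
        differentiated; uniqueness of the derivative gives the next case.\<close>
      have "((\<lambda>x. x * W (Suc k) x) has_real_derivative
          W (Suc k) x + x * W (Suc (Suc k)) x) (at x)"
        by (auto intro!: derivative_eq_intros D[OF x])
      moreover have "((\<lambda>x. x * W (Suc k) x) has_real_derivative
          (real n - real k) * W (Suc k) x) (at x)"
      proof (rule has_field_derivative_transform_within_open)
        show "((\<lambda>x. (real n - real k) * W k x) has_real_derivative
            (real n - real k) * W (Suc k) x) (at x)"
          by (auto intro!: derivative_eq_intros D[OF x])
      qed (use assms(1) x Suc in auto)
      ultimately have "W (Suc k) x + x * W (Suc (Suc k)) x = (real n - real k) * W (Suc k) x"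
        by (rule DERIV_unique)
      then show "x * W (Suc (Suc k)) x = (real n - real (Suc k)) * W (Suc k) x"
        by (simp add: algebra_simps)
    qed
  qed
  have "\<exists>c. \<forall>x\<in>S. W n x = c"
  proof (cases "S = {}")
    case False
    then obtain a where a: "a \<in> S" by blast
    \<comment> \<open>At k = n the recursion reads x * \<open>W (Suc n) x\<close> = 0, which says
      nothing at x = 0. Hence the criterion for constancy that admits a finite exceptional set, here
      {0}, on which continuity suffices.\<close>
    have "W n x = W n a" if "x \<in> S" for x
    proof (rule has_derivative_zero_unique_strong_convex[of S "{0}" "W n" a])
      show "continuous_on S (W n)"
        using D by (meson DERIV_isCont continuous_at_imp_continuous_on)
      show "(W n has_derivative (\<lambda>h. 0)) (at z within S)" if "z \<in> S - {0}" for z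
      proof -
        have "W (Suc n) z = 0" using rec[of n] that by auto
        then have "(W n has_real_derivative 0) (at z within S)"
          using D[of z n] that has_field_derivative_at_within by fastforce
        then show ?thesis by (simp add: has_field_derivative_def lambda_zero)
      qed
    qed (use assms(2) a that in auto)
    then show ?thesis by blast
  qed simp
  then have top: "\<exists>c. \<forall>x\<in>S. W (n - 0) x = c * x ^ 0" by simp
  have "\<exists>c. \<forall>x\<in>S. W (n - j) x = c * x ^ j" if "j \<le> n" for j
    using that
  proof (induction j)
    case 0
    show ?case by (rule top)
  next
    case (Suc j)
    then obtain c where c: "\<forall>x\<in>S. W (n - j) x = c * x ^ j" by auto
    \<comment> \<open>For k = n - (j+1) the factor n - k is j + 1, which is nonzero, so the
      recursion determines \<open>W k\<close> from \<open>W (n - j)\<close> at every point, 0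
      included.\<close>
    have "W (n - Suc j) x = (c / real (Suc j)) * x ^ Suc j" if "x \<in> S" for x
      using rec[of "n - Suc j"] c that Suc.prems
      by (auto simp: Suc_diff_Suc of_nat_diff field_simps)
    then show ?case by blast
  qed
  from this[of n] show ?thesis by simp
qed

lemma solutions_of_shifted_derivative_eq:
  fixes y y' :: "real \<Rightarrow> real" and e :: "real poly"
  assumes "convex S"
    and e: "\<forall>x. poly (pderiv e) x + poly e x = x ^ n"
    and D: "\<And>x. x \<in> S \<Longrightarrow> (y has_real_derivative y' x) (at x)"
    and eq: "\<And>x. x \<in> S \<Longrightarrow> y' x + y x = c * x ^ n"
  shows "\<exists>d. \<forall>x\<in>S. y x = d * exp (- x) + c * poly e x"
proof -
  \<comment> \<open>\<open>exp x\<close> is the integrating factor of z' + z = 0 for z = y - c e;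
    the constant value of the product becomes d.\<close>
  have "((\<lambda>x. (y x - c * poly e x) * exp x) has_real_derivative 0) (at x within S)"
    if x: "x \<in> S" for x
  proof -
    have "(y' x - c * poly (pderiv e) x) * exp x + exp x * (y x - c * poly e x)
        = exp x * ((y' x + y x) - c * (poly (pderiv e) x + poly e x))"
      by (simp add: algebra_simps)
    also have "\<dots> = 0" using eq[OF x] e by simp
    finally have "(y' x - c * poly (pderiv e) x) * exp x + exp x * (y x - c * poly e x) = 0" .
    then show ?thesis
      using DERIV_mult[OF DERIV_diff[OF D[OF x] DERIV_cmult[OF poly_DERIV]] DERIV_exp, of c e]
      by (simp add: has_field_derivative_at_within)
  qed
  from has_field_derivative_zero_constant[OF assms(1) this]
  obtain d where d: "(y x - c * poly e x) * exp x = d" if "x \<in> S" for x by blast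
  have "y x = d * exp (- x) + c * poly e x" if "x \<in> S" for x
    using d[OF that] by (simp add: exp_minus field_simps)
  then show ?thesis by blast
qed

lemma solves_ode_on_imp_combination:
  fixes e :: "real poly"
  assumes e: "\<forall>x. poly (pderiv e) x + poly e x = x ^ n"
    and S: "open S" "is_interval S"
    and y: "solves_ode_on n S y"
    and smooth: "0 \<in> S \<Longrightarrow> infinitely_differentiable_on y S"
  shows "\<exists>C1 C2. \<forall>x\<in>S. y x = C1 * exp (- x) + C2 * poly e x"
proof -
  have cv: "convex S" using S is_interval_convex by blast
  have D1: "(y has_real_derivative deriv y x) (at x)"
    and D2: "(deriv y has_real_derivative deriv (deriv y) x) (at x)"
    and ode: "x * deriv (deriv y) x + (x - real n) * deriv y x - real n * y x = 0"
    if "x \<in> S" for x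
    using y S that by (auto simp: solves_ode_on_def intro: differentiable_on_open_DERIV_deriv)
  have euler: "x * (deriv y x + deriv (deriv y) x) = real n * (y x + deriv y x)"
    if "x \<in> S" for x
    using ode[OF that] by (simp add: algebra_simps)
  have "\<exists>c. \<forall>x\<in>S. y x + deriv y x = c * x ^ n"
  proof (cases "0 \<in> S")
    case False
    show ?thesis
      by (rule euler_ode_solution_away_from_zero[OF cv False _ euler])
        (auto intro!: derivative_eq_intros D1 D2)
  next
    case True
    \<comment> \<open>The k-th derivative of y + y' is written as a sum of two iterated derivatives
      of y, so that it can be differentiated term by term.\<close>
    let ?W = "\<lambda>k x. (deriv ^^ k) y x + (deriv ^^ Suc k) y x"
    have Dk: "((deriv ^^ k) y has_real_derivative (deriv ^^ Suc k) y x) (at x)"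
      if "x \<in> S" for k x
      using differentiable_on_open_DERIV_deriv[OF _ S(1) that] smooth[OF True]
      by (simp add: infinitely_differentiable_on_def)
    have "\<exists>c. \<forall>x\<in>S. ?W 0 x = c * x ^ n"
    proof (rule euler_ode_smooth_solution[OF S(1) cv])
      show "(?W k has_real_derivative ?W (Suc k) x) (at x)" if "x \<in> S" for k x
        using Dk[OF that] by (intro DERIV_add)
    qed (use euler in simp)
    then show ?thesis by simp
  qed
  then obtain c where "\<forall>x\<in>S. deriv y x + y x = c * x ^ n" by (auto simp: add.commute)
  then show ?thesis
    using solutions_of_shifted_derivative_eq[OF cv e D1] by blast
qed

text \<open>The operator y' + y annihilates the exponential and sends \<open>e\<close> to x^n, so a
  vanishing combination yields a x^n = 0. A point other than 0 then forces a = 0, and b = 0 follows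
  since the exponential has no zeros.\<close>

lemma linearly_independent_pair_poly_exp:
  fixes e :: "real poly"
  assumes e: "\<forall>x. poly (pderiv e) x + poly e x = x ^ n"
    and S: "open S" "S \<noteq> {}"
  shows "linearly_independent_pair_on S (poly e) (\<lambda>x. exp (- x))"
  unfolding linearly_independent_pair_on_def
proof (intro allI impI)
  fix a b assume z: "\<forall>x\<in>S. a * poly e x + b * exp (- x) = 0"
  have "infinite S" using S finite_imp_not_open by blast
  then obtain x where x: "x \<in> S" "x \<noteq> 0"
    by (metis finite.emptyI finite.insertI finite_subset insertCI subsetI)
  have "((\<lambda>x. a * poly e x + b * exp (- x)) has_real_derivative
      a * poly (pderiv e) x - b * exp (- x)) (at x)"
    by (auto intro!: derivative_eq_intros)
  \<comment> \<open>The combination agrees with the zero function on the open neighbourhood S of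
    x.\<close>
  moreover have "((\<lambda>x. a * poly e x + b * exp (- x)) has_real_derivative 0) (at x)"
    by (rule has_field_derivative_transform_within_open[OF DERIV_const S(1) x(1)])
      (use z in auto)
  ultimately have "a * poly (pderiv e) x - b * exp (- x) = 0"
    by (rule DERIV_unique)
  with z x(1) have "a * (poly (pderiv e) x + poly e x) = 0" by (auto simp: algebra_simps)
  with e x(2) have "a = 0" by simp
  with z x(1) show "a = 0 \<and> b = 0" by auto
qed

theorem mainTheorem7:
  fixes n :: nat and e :: "real poly"
  assumes "degree e = n"
    and "\<forall>x. poly (pderiv e) x + poly e x = x ^ n"
  shows "general_solution_of_ode n (\<lambda>x. exp (- x)) (poly e)
    \<and> solves_ode_on n UNIV (poly e)
    \<and> solves_ode_on n UNIV (\<lambda>x. exp (- x))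
    \<and> (\<forall>S. open S \<and> is_interval S \<and> S \<noteq> {} \<longrightarrow>
          linearly_independent_pair_on S (poly e) (\<lambda>x. exp (- x)))"
proof (intro conjI allI impI)
  note comb = solves_ode_on_combination[OF assms(2)]
  show "general_solution_of_ode n (\<lambda>x. exp (- x)) (poly e)"
    unfolding general_solution_of_ode_def
    using comb solves_ode_on_imp_combination[OF assms(2)] by blast
  show "solves_ode_on n UNIV (poly e)" using comb[of 0 1] by simp
  show "solves_ode_on n UNIV (\<lambda>x. exp (- x))" using comb[of 1 0] by simp
qed (use linearly_independent_pair_poly_exp[OF assms(2)] in blast)

end
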